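(* Let $G=(V,E)$ and $G'=(V',E')$ be graphs, let $\mathcal{S}$ be a set of distributions on $G$ and $\mathcal{S}'$ a set of distributions on $G'$. If $D$ is an $\mathcal{S}$-solvable distribution on $G$ and $D'$ is an $\mathcal{S}'$-solvable distribution on $G'$, then $D\cdot D'$ is an $(\mathcal{S}\cdot\mathcal{S}')$-solvable distribution on $G\Box G'$. In particular, $\pi^*(G\Box G',\mathcal{S}\cdot\mathcal{S}')\le \pi^*(G,\mathcal{S})\,\pi^*(G',\mathcal{S}')$.
   Context: Graphs are finite simple graphs. A distribution on a graph $G=(V,E)$ is a function $D:V\to\mathbb{N}$ (number of pebbles on each vertex), with size $|D|=\sum_{v\in V}D(v)$. $D$ contains $D'$ if $D'(v)\le D(v)$ for all $v$. A pebbling move removes two pebbles from a vertex having at least two pebbles and places one pebble on a neighbor of that vertex. $D_2$ is reachable from $D_1$ if some sequence of pebbling moves starting from $D_1$ results in a distribution containing $D_2$. For a set $\mathcal{S}$ of distributions on $G$, $D$ is $\mathcal{S}$-solvable if every distribution in $\mathcal{S}$ is reachable from $D$; $\pi^*(G,\mathcal{S})$ is the smallest size of an $\mathcal{S}$-solvable distribution on $G$. The Cartesian product $G\Box G'$ has vertex set $V\times V'$, with $(x,x')$ adjacent to $(y,x')$ when $xy\in E$ and $(x,x')$ adjacent to $(x,y')$ when $x'y'\in E'$. For distributions $D$ on $G$ and $D'$ on $G'$, $D\cdot D'$ is the distribution on $G\Box G'$ with $(D\cdot D')((x,x'))=D(x)D'(x')$; for sets of distributions, $\mathcal{S}\cdot\mathcal{S}'=\{D\cdot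 D': D\in\mathcal{S}, D'\in\mathcal{S}'\}$. *)

theory Defs
  imports
    "Graph_Theory.Pair_Digraph"
    "HOL-Library.Extended_Nat"
begin

text \<open>
  A finite simple graph is a \<^term>\<open>G :: 'a pair_pre_digraph\<close> with \<^prop>\<open>pair_graph G\<close>:
  finitely many vertices and a symmetric, loopless arc relation, an edge \<open>xy\<close> being
  represented by the two arcs \<open>(x, y)\<close> and \<open>(y, x)\<close>.

  A function \<open>V \<rightarrow> \<nat>\<close> is represented by a total function that vanishes outside \<open>V\<close>.
\<close>

definition distributions :: "'a pair_pre_digraph \<Rightarrow> ('a \<Rightarrow> nat) set" where
  "distributions G = {D. \<forall>v. v \<notin> pverts G \<longrightarrow> D v = 0}"

definition dist_size :: "'a pair_pre_digraph \<Rightarrow> ('a \<Rightarrow> nat) \<Rightarrow> nat" where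
  "dist_size G D = (\<Sum>v\<in>pverts G. D v)"

definition dist_contains :: "'a pair_pre_digraph \<Rightarrow> ('a \<Rightarrow> nat) \<Rightarrow> ('a \<Rightarrow> nat) \<Rightarrow> bool" where
  "dist_contains G D D' \<longleftrightarrow> (\<forall>v\<in>pverts G. D' v \<le> D v)"

definition pebbling_move :: "'a pair_pre_digraph \<Rightarrow> ('a \<Rightarrow> nat) \<Rightarrow> ('a \<Rightarrow> nat) \<Rightarrow> bool" where
  "pebbling_move G D D' \<longleftrightarrow>
     (\<exists>u v. (u, v) \<in> parcs G \<and> 2 \<le> D u \<and> D' = D(u := D u - 2, v := D v + 1))"

definition reachable_dist :: "'a pair_pre_digraph \<Rightarrow> ('a \<Rightarrow> nat) \<Rightarrow> ('a \<Rightarrow> nat) \<Rightarrow> bool" where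
  "reachable_dist G D\<^sub>1 D\<^sub>2 \<longleftrightarrow> (\<exists>D. (pebbling_move G)\<^sup>*\<^sup>* D\<^sub>1 D \<and> dist_contains G D D\<^sub>2)"

definition solvable :: "'a pair_pre_digraph \<Rightarrow> ('a \<Rightarrow> nat) set \<Rightarrow> ('a \<Rightarrow> nat) \<Rightarrow> bool" where
  "solvable G S D \<longleftrightarrow> (\<forall>D'\<in>S. reachable_dist G D D')"

text \<open>
  The values lie in \<^typ>\<open>enat\<close> because a solvable distribution need not exist: \<open>S\<close> may contain
  distributions of unbounded size. In that case the value is \<open>\<infinity>\<close>; otherwise the
  infimum of a nonempty set of \<^typ>\<open>enat\<close> is its least element.
\<close>

definition opt_pebbling :: "'a pair_pre_digraph \<Rightarrow> ('a \<Rightarrow> nat) set \<Rightarrow> enat" where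
  "opt_pebbling G S = Inf {enat (dist_size G D) | D. D \<in> distributions G \<and> solvable G S D}"

definition cart_prod ::
    "'a pair_pre_digraph \<Rightarrow> 'b pair_pre_digraph \<Rightarrow> ('a \<times> 'b) pair_pre_digraph" where
  "cart_prod G G' =
     \<lparr> pverts = pverts G \<times> pverts G',
       parcs = {((x, x'), (y, x')) | x y x'. (x, y) \<in> parcs G \<and> x' \<in> pverts G'}
             \<union> {((x, x'), (x, y')) | x x' y'. x \<in> pverts G \<and> (x', y') \<in> parcs G'} \<rparr>"

definition dist_prod :: "('a \<Rightarrow> nat) \<Rightarrow> ('b \<Rightarrow> nat) \<Rightarrow> ('a \<times> 'b \<Rightarrow> nat)" where
  "dist_prod D D' = (\<lambda>(x, x'). D x * D' x')"

definition dist_set_prod ::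
    "('a \<Rightarrow> nat) set \<Rightarrow> ('b \<Rightarrow> nat) set \<Rightarrow> ('a \<times> 'b \<Rightarrow> nat) set" where
  "dist_set_prod S S' = {dist_prod D D' | D D'. D \<in> S \<and> D' \<in> S'}"

lemma pair_graph_cart_prod:
  assumes "pair_graph G" and "pair_graph G'"
  shows "pair_graph (cart_prod G G')"
proof -
  interpret G: pair_graph G by fact
  interpret H: pair_graph G' by fact
  have wf: "parcs (cart_prod G G') \<subseteq> pverts (cart_prod G G') \<times> pverts (cart_prod G G')"
    by (auto simp: cart_prod_def dest: G.wellformed' H.wellformed')
  have fin: "finite (pverts (cart_prod G G'))"
    by (simp add: cart_prod_def)
  have "sym (parcs G)" "sym (parcs G')"
    using G.pair_sym_arcs H.pair_sym_arcs by (simp_all add: symmetric_def)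
  then have sym: "sym (parcs (cart_prod G G'))"
    unfolding cart_prod_def sym_def by auto
  show ?thesis
  proof
    fix e assume e: "e \<in> parcs (cart_prod G G')"
    show "fst e \<in> pverts (cart_prod G G')" "snd e \<in> pverts (cart_prod G G')"
      using e wf by auto
    show "fst e \<noteq> snd e"
      using e by (auto simp: cart_prod_def dest: G.pair_no_loops H.pair_no_loops)
  next
    show "finite (pverts (cart_prod G G'))" by (fact fin)
    show "finite (parcs (cart_prod G G'))"
      using wf fin by (meson finite_SigmaI finite_subset)
    show "symmetric (with_proj (cart_prod G G'))"
      using sym by (simp add: symmetric_def)
  qed
qed

lemma dist_prod_in_distributions:
  "D \<in> distributions G \<Longrightarrow> D' \<in> distributions G' \<Longrightarrow>
     dist_prod D D' \<in> distributions (cart_prod G G')"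
  by (auto simp: distributions_def dist_prod_def cart_prod_def)

end

theory Submission
  imports Defs
begin

text \<open>
  Pebbling sequences can be run side by side, so they are closed under sums. The product
  \<open>D \<cdot> D'\<close> is the sum, over the vertices \<open>y\<close> of \<open>G'\<close>, of \<open>D' y\<close> copies of \<open>D\<close> placed on the
  fibre \<open>G \<times> {y}\<close>, so \<open>D \<longrightarrow>\<^sup>* E\<close> gives \<open>D \<cdot> D' \<longrightarrow>\<^sup>* E \<cdot> D'\<close>; then likewise
  \<open>E \<cdot> D' \<longrightarrow>\<^sup>* E \<cdot> E'\<close>, and \<open>E \<cdot> E'\<close> contains \<open>T \<cdot> T'\<close> whenever \<open>E\<close> contains \<open>T\<close> and \<open>E'\<close> contains \<open>T'\<close>.
\<close>

text \<open>Additional pebbles never block a move: the source still holds at least two, and because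
  \<open>2 \<le> D u\<close> the truncated subtraction commutes with adding
  \<open>F\<close>.\<close>

lemma pebbling_move_add:
  assumes "pebbling_move G D E"
  shows "pebbling_move G (\<lambda>v. D v + F v) (\<lambda>v. E v + F v)"
proof -
  obtain u v where uv: "(u, v) \<in> parcs G" "2 \<le> D u" "E = D(u := D u - 2, v := D v + 1)"
    using assms by (auto simp: pebbling_move_def)
  have "(\<lambda>w. E w + F w) =
    (\<lambda>w. D w + F w)(u := D u + F u - 2, v := D v + F v + 1)"
    using uv by (auto simp: fun_eq_iff)
  moreover have "2 \<le> D u + F u"
    using uv by simp
  ultimately show ?thesis
    unfolding pebbling_move_def using uv(1) by blast
qed

text \<open>First \<open>D\<close> moves to \<open>E\<close> while \<open>D'\<close> stays idle,
  then \<open>D'\<close> moves to \<open>E'\<close> while \<open>E\<close> stays idle.\<close>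

lemma pebbling_moves_add:
  assumes "(pebbling_move G)\<^sup>*\<^sup>* D E" and "(pebbling_move G)\<^sup>*\<^sup>* D' E'"
  shows "(pebbling_move G)\<^sup>*\<^sup>* (\<lambda>v. D v + D' v) (\<lambda>v. E v + E' v)"
proof -
  have right: "(pebbling_move G)\<^sup>*\<^sup>* (\<lambda>v. A v + C v) (\<lambda>v. B v + C v)"
    if "(pebbling_move G)\<^sup>*\<^sup>* A B" for A B C
    using that by induction (simp, erule rtranclp.rtrancl_into_rtrancl, erule pebbling_move_add)
  show ?thesis
    using right[OF assms(1), of D'] right[OF assms(2), of E]
    by (simp add: add.commute)
qed

lemma pebbling_moves_sum:
  assumes "finite I" and "\<And>i. i \<in> I \<Longrightarrow> (pebbling_move G)\<^sup>*\<^sup>* (f i) (g i)"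
  shows "(pebbling_move G)\<^sup>*\<^sup>* (\<lambda>v. \<Sum>i\<in>I. f i v) (\<lambda>v. \<Sum>i\<in>I. g i v)"
  using assms by (induction rule: finite_induct) (simp_all add: pebbling_moves_add)

text \<open>\<open>k * D\<close> is the sum of \<open>k\<close> copies of \<open>D\<close>, each of
  which runs the same sequence.\<close>

lemma pebbling_moves_mult:
  assumes "(pebbling_move G)\<^sup>*\<^sup>* D E"
  shows "(pebbling_move G)\<^sup>*\<^sup>* (\<lambda>v. k * D v) (\<lambda>v. k * E v)"
  using pebbling_moves_sum[of "{..<k}" G "\<lambda>_. D" "\<lambda>_. E"] assms by simp

text \<open>Both ends of an arc are vertices, so no pebble ever leaves the vertex set. This lets an
  intermediate result serve as the fixed factor of a product.\<close>

lemma pebbling_moves_in_distributions: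
  assumes "pair_graph G" and "(pebbling_move G)\<^sup>*\<^sup>* D E" and "D \<in> distributions G"
  shows "E \<in> distributions G"
proof -
  interpret pair_graph G by fact
  show ?thesis
    using assms(2,3)
    by induction (auto simp: distributions_def pebbling_move_def dest: wellformed')
qed

text \<open>The arc \<open>(u, v)\<close> lifts to the arc from \<open>(u, y)\<close> to
  \<open>(v, y)\<close>, so the fibre over \<open>y\<close> behaves as a copy of
  \<open>G\<close>.\<close>

lemma pebbling_move_fibre_left:
  assumes "pebbling_move G D E" and "y \<in> pverts G'"
  shows "pebbling_move (cart_prod G G')
    (\<lambda>(x, z). if z = y then D x else 0) (\<lambda>(x, z). if z = y then E x else 0)"
proof -
  obtain u v where uv: "(u, v) \<in> parcs G" "2 \<le> D u" "E = D(u := D u - 2, v := D v + 1)"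
    using assms(1) by (auto simp: pebbling_move_def)
  have "((u, y), (v, y)) \<in> parcs (cart_prod G G')"
    using uv(1) assms(2) by (simp add: cart_prod_def)
  then show ?thesis
    unfolding pebbling_move_def
    by (intro exI[of _ "(u, y)"] exI[of _ "(v, y)"]) (use uv in \<open>auto simp: fun_eq_iff\<close>)
qed

lemma pebbling_moves_dist_prod_left:
  fixes G :: "'a pair_pre_digraph" and G' :: "'b pair_pre_digraph"
  assumes "finite (pverts G')" and "F \<in> distributions G'" and "(pebbling_move G)\<^sup>*\<^sup>* D E"
  shows "(pebbling_move (cart_prod G G'))\<^sup>*\<^sup>* (dist_prod D F) (dist_prod E F)"
proof -
  define fibre where "fibre y A = (\<lambda>(x, z). if z = y then A x else 0)" for y :: "'b" and A :: "'a \<Rightarrow> nat"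
  have "(pebbling_move (cart_prod G G'))\<^sup>*\<^sup>* (fibre y D) (fibre y E)" if "y \<in> pverts G'" for y
    using assms(3)
    unfolding fibre_def
    by induction (simp, erule rtranclp.rtrancl_into_rtrancl, erule pebbling_move_fibre_left, rule that)
  then have "(pebbling_move (cart_prod G G'))\<^sup>*\<^sup>*
      (\<lambda>p. \<Sum>y\<in>pverts G'. F y * fibre y D p) (\<lambda>p. \<Sum>y\<in>pverts G'. F y * fibre y E p)"
    by (intro pebbling_moves_sum assms(1) pebbling_moves_mult)
  moreover have "(\<lambda>p. \<Sum>y\<in>pverts G'. F y * fibre y A p) = dist_prod A F" for A
  proof
    fix p :: "'a \<times> 'b"
    obtain x z where p: "p = (x, z)"
      by fastforce
    \<comment> \<open>At most the summand \<open>y = z\<close> survives. For \<open>z\<close>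
      outside \<open>pverts G'\<close> the sum is empty of such terms, and the product vanishes too
      because \<open>F z = 0\<close>.\<close>
    have "F y * fibre y A p = (if z = y then F y * A x else 0)" for y
      by (simp add: fibre_def p)
    then show "(\<Sum>y\<in>pverts G'. F y * fibre y A p) = dist_prod A F p"
      using assms(1,2) by (auto simp: p dist_prod_def distributions_def)
  qed
  ultimately show ?thesis
    by simp
qed

lemma pebbling_move_fibre_right:
  assumes "pebbling_move G' D E" and "y \<in> pverts G"
  shows "pebbling_move (cart_prod G G')
    (\<lambda>(z, x). if z = y then D x else 0) (\<lambda>(z, x). if z = y then E x else 0)"
proof -
  obtain u v where uv: "(u, v) \<in> parcs G'" "2 \<le> D u" "E = D(u := D u - 2, v := D v + 1)"
    using assms(1) by (auto simp: pebbling_move_def)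
  have "((y, u), (y, v)) \<in> parcs (cart_prod G G')"
    using uv(1) assms(2) by (simp add: cart_prod_def)
  then show ?thesis
    unfolding pebbling_move_def
    by (intro exI[of _ "(y, u)"] exI[of _ "(y, v)"]) (use uv in \<open>auto simp: fun_eq_iff\<close>)
qed

text \<open>Mirror image of \<open>pebbling_moves_dist_prod_left\<close>, with the fibres being
  copies of \<open>G'\<close> indexed by the vertices of \<open>G\<close>.\<close>

lemma pebbling_moves_dist_prod_right:
  fixes G :: "'a pair_pre_digraph" and G' :: "'b pair_pre_digraph"
  assumes "finite (pverts G)" and "F \<in> distributions G" and "(pebbling_move G')\<^sup>*\<^sup>* D E"
  shows "(pebbling_move (cart_prod G G'))\<^sup>*\<^sup>* (dist_prod F D) (dist_prod F E)"
proof -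
  define fibre where "fibre y A = (\<lambda>(z, x). if z = y then A x else 0)" for y :: "'a" and A :: "'b \<Rightarrow> nat"
  have "(pebbling_move (cart_prod G G'))\<^sup>*\<^sup>* (fibre y D) (fibre y E)" if "y \<in> pverts G" for y
    using assms(3)
    unfolding fibre_def
    by induction (simp, erule rtranclp.rtrancl_into_rtrancl, erule pebbling_move_fibre_right, rule that)
  then have "(pebbling_move (cart_prod G G'))\<^sup>*\<^sup>*
      (\<lambda>p. \<Sum>y\<in>pverts G. F y * fibre y D p) (\<lambda>p. \<Sum>y\<in>pverts G. F y * fibre y E p)"
    by (intro pebbling_moves_sum assms(1) pebbling_moves_mult)
  moreover have "(\<lambda>p. \<Sum>y\<in>pverts G. F y * fibre y A p) = dist_prod F A" for A
  proof
    fix p :: "'a \<times> 'b"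
    obtain z x where p: "p = (z, x)"
      by fastforce
    have "F y * fibre y A p = (if z = y then F y * A x else 0)" for y
      by (simp add: fibre_def p)
    then show "(\<Sum>y\<in>pverts G. F y * fibre y A p) = dist_prod F A p"
      using assms(1,2) by (auto simp: p dist_prod_def distributions_def)
  qed
  ultimately show ?thesis
    by simp
qed

lemma solvable_dist_prod:
  assumes "pair_graph G" and "pair_graph G'"
    and "D \<in> distributions G" and "D' \<in> distributions G'"
    and "solvable G S D" and "solvable G' S' D'"
  shows "solvable (cart_prod G G') (dist_set_prod S S') (dist_prod D D')"
  unfolding solvable_def
proof
  interpret G: pair_graph G by fact
  interpret G': pair_graph G' by fact
  fix U assume "U \<in> dist_set_prod S S'"
  then obtain T T' where U: "U = dist_prod T T'" and "T \<in> S" "T' \<in> S'"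
    by (auto simp: dist_set_prod_def)
  then obtain E E' where
    E: "(pebbling_move G)\<^sup>*\<^sup>* D E" "dist_contains G E T" and
    E': "(pebbling_move G')\<^sup>*\<^sup>* D' E'" "dist_contains G' E' T'"
    using assms(5,6) unfolding solvable_def reachable_dist_def by blast
  \<comment> \<open>In the second phase \<open>E\<close> is the idle factor, so it has to vanish off
    the vertices of \<open>G\<close>.\<close>
  have "E \<in> distributions G"
    using pebbling_moves_in_distributions[OF assms(1) E(1) assms(3)] .
  then have "(pebbling_move (cart_prod G G'))\<^sup>*\<^sup>* (dist_prod D D') (dist_prod E E')"
    using pebbling_moves_dist_prod_left[OF G'.pair_finite_verts assms(4) E(1)]
      pebbling_moves_dist_prod_right[OF G.pair_finite_verts _ E'(1)]
    by (meson rtranclp_trans)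
  moreover have "dist_contains (cart_prod G G') (dist_prod E E') U"
    using E(2) E'(2)
    by (auto simp: U dist_contains_def cart_prod_def dist_prod_def intro: mult_le_mono)
  ultimately show "reachable_dist (cart_prod G G') (dist_prod D D') U"
    unfolding reachable_dist_def by blast
qed

lemma dist_size_dist_prod:
  "dist_size (cart_prod G G') (dist_prod D D') = dist_size G D * dist_size G' D'"
  by (simp add: dist_size_def cart_prod_def dist_prod_def sum_product sum.cartesian_product)

lemma opt_pebbling_le:
  "D \<in> distributions G \<Longrightarrow> solvable G S D \<Longrightarrow> opt_pebbling G S \<le> enat (dist_size G D)"
  unfolding opt_pebbling_def by (rule Inf_lower) blast

text \<open>A finite value rules out the empty set, whose infimum is \<open>\<infinity>\<close>; a
  nonempty set in the well-order \<open>enat\<close> contains its infimum.\<close>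

lemma opt_pebbling_attained:
  assumes "opt_pebbling G S \<noteq> \<infinity>"
  obtains D where "D \<in> distributions G" and "solvable G S D"
    and "opt_pebbling G S = enat (dist_size G D)"
proof -
  let ?A = "{enat (dist_size G D) | D. D \<in> distributions G \<and> solvable G S D}"
  have "?A \<noteq> {}"
    using assms unfolding opt_pebbling_def by (metis Inf_empty top_enat_def)
  then obtain k where "k \<in> ?A"
    by blast
  then have "Inf ?A \<in> ?A"
    by (rule wellorder_InfI)
  with that show thesis
    unfolding opt_pebbling_def by blast
qed

text \<open>Value 0 is attained by the zero distribution, which admits no move and so contains every
  target as it stands.\<close>

lemma opt_pebbling_eq_0D:
  assumes "pair_graph G" and "opt_pebbling G S = 0" and "T \<in> S" and "T \<in> distributions G"
  shows "T = (\<lambda>_. 0)"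
proof -
  interpret pair_graph G by fact
  obtain D where D: "D \<in> distributions G" "solvable G S D" "dist_size G D = 0"
    using opt_pebbling_attained[of G S] assms(2) by (metis enat_0_iff(1) i0_ne_infinity)
  then have "D = (\<lambda>_. 0)"
    by (auto simp: dist_size_def distributions_def fun_eq_iff)
  moreover have "E = D" if "(pebbling_move G)\<^sup>*\<^sup>* D E" for E
    \<comment> \<open>A nonempty sequence would start with a move from a vertex with two
      pebbles.\<close>
    using that \<open>D = (\<lambda>_. 0)\<close> by (cases rule: converse_rtranclpE) (simp_all add: pebbling_move_def)
  ultimately have "dist_contains G (\<lambda>_. 0) T"
    using D(2) assms(3) unfolding solvable_def reachable_dist_def by blast
  then show ?thesis
    using assms(4) by (auto simp: dist_contains_def distributions_def fun_eq_iff)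
qed

lemma opt_pebbling_eq_0I:
  assumes "\<And>T. T \<in> S \<Longrightarrow> T = (\<lambda>_. 0)"
  shows "opt_pebbling G S = 0"
proof -
  have "solvable G S (\<lambda>_. 0)"
    using assms by (fastforce simp: solvable_def reachable_dist_def dist_contains_def)
  then have "opt_pebbling G S \<le> enat (dist_size G (\<lambda>_. 0))"
    by (intro opt_pebbling_le) (simp_all add: distributions_def)
  then show ?thesis
    by (simp add: dist_size_def zero_enat_def[symmetric])
qed

lemma opt_pebbling_cart_prod_le:
  assumes "pair_graph G" and "pair_graph G'"
    and "S \<subseteq> distributions G" and "S' \<subseteq> distributions G'"
  shows "opt_pebbling (cart_prod G G') (dist_set_prod S S') \<le> opt_pebbling G S * opt_pebbling G' S'"
proof -
  \<comment> \<open>The cases are exhaustive: if neither factor is 0 and one is infinite, the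
    product is infinite.\<close>
  consider "opt_pebbling G S = 0 \<or> opt_pebbling G' S' = 0"
    | "opt_pebbling G S \<noteq> \<infinity>" "opt_pebbling G' S' \<noteq> \<infinity>"
    | "opt_pebbling G S * opt_pebbling G' S' = \<infinity>"
    unfolding imult_is_infinity by metis
  then show ?thesis
  proof cases
    \<comment> \<open>Treated separately because the other factor may be \<open>\<infinity>\<close>, and \<open>0 * \<infinity> = 0\<close> in \<^typ>\<open>enat\<close>.\<close>
    case 1
    then have "U = (\<lambda>_. 0)" if "U \<in> dist_set_prod S S'" for U
      using that opt_pebbling_eq_0D[OF assms(1)] opt_pebbling_eq_0D[OF assms(2)] assms(3,4)
      by (fastforce simp: dist_set_prod_def dist_prod_def)
    then show ?thesis
      by (simp add: opt_pebbling_eq_0I)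
  next
    case 2
    obtain D where D: "D \<in> distributions G" "solvable G S D"
      "opt_pebbling G S = enat (dist_size G D)"
      using 2(1) by (rule opt_pebbling_attained)
    obtain D' where D': "D' \<in> distributions G'" "solvable G' S' D'"
      "opt_pebbling G' S' = enat (dist_size G' D')"
      using 2(2) by (rule opt_pebbling_attained)
    \<comment> \<open>The product of two minimizers is solvable, hence a candidate for the infimum,
      and sizes multiply.\<close>
    have "opt_pebbling (cart_prod G G') (dist_set_prod S S')
        \<le> enat (dist_size (cart_prod G G') (dist_prod D D'))"
      using assms(1,2) D D'
      by (intro opt_pebbling_le dist_prod_in_distributions solvable_dist_prod)
    then show ?thesis
      by (simp add: dist_size_dist_prod D(3) D'(3))
  next
    case 3
    then show ?thesis
      by simp
  qed
qed

theorem theorem2p3: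
  fixes G :: "'a pair_pre_digraph" and G' :: "'b pair_pre_digraph"
    and S :: "('a \<Rightarrow> nat) set" and S' :: "('b \<Rightarrow> nat) set"
  assumes "pair_graph G" and "pair_graph G'"
    and "S \<subseteq> distributions G" and "S' \<subseteq> distributions G'"
  shows "(\<forall>D\<in>distributions G. \<forall>D'\<in>distributions G'.
            solvable G S D \<longrightarrow> solvable G' S' D' \<longrightarrow>
              dist_prod D D' \<in> distributions (cart_prod G G') \<and>
              solvable (cart_prod G G') (dist_set_prod S S') (dist_prod D D'))
       \<and> opt_pebbling (cart_prod G G') (dist_set_prod S S')
           \<le> opt_pebbling G S * opt_pebbling G' S'"
  using assms
  by (simp add: dist_prod_in_distributions solvable_dist_prod opt_pebbling_cart_prod_le)

end
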